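(* Let $\omega$ be an infinite word on a finite alphabet having bounded Abelian complexity (i.e. the function $n\mapsto\rho^{\mathrm{ab}}_\omega(n)$ is bounded). Then $\omega$ contains an Abelian $k$-power (as a factor) for every positive integer $k$.
   Context: A factor of an infinite word is a finite block of consecutive letters of it. Two finite words are Abelian equivalent if every letter occurs the same number of times in both; $\rho^{\mathrm{ab}}_{\omega}(n)$ is the number of Abelian equivalence classes of factors of $\omega$ of length $n$. An Abelian $k$-power is a non-empty word of the form $u_1u_2\cdots u_k$ where the words $u_1,\dots,u_k$ are pairwise Abelian equivalent. *)

theory Defs
  imports Main "HOL-Library.Omega_Words_Fun"
begin

definition factors :: "'a word \<Rightarrow> 'a list set" where
  "factors w = {w[i \<rightarrow> j] | i j. i \<le> j}"

definition abelian_equiv :: "'a list \<Rightarrow> 'a list \<Rightarrow> bool" where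
  "abelian_equiv u v \<longleftrightarrow> (\<forall>a. count_list u a = count_list v a)"

text \<open>
  The relation below is taken on all finite words, so the members of the quotient are full
  classes that contain at least one factor of length n; they correspond one-to-one to the
  classes of the relation restricted to these factors. Over a finite alphabet the quotient is
  finite, so its cardinality is not the default value 0 for infinite sets.
\<close>
definition abelian_complexity :: "'a word \<Rightarrow> nat \<Rightarrow> nat" where
  "abelian_complexity w n =
     card ({u \<in> factors w. length u = n} // {(u, v). abelian_equiv u v})"

definition abelian_power :: "nat \<Rightarrow> 'a list \<Rightarrow> bool" where
  "abelian_power k x \<longleftrightarrow> x \<noteq> [] \<and>
     (\<exists>us. length us = k \<and> x = concat us \<and>
        (\<forall>u\<in>set us. \<forall>v\<in>set us. abelian_equiv u v))"

end

theory Submission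
  imports Defs "HOL-Library.Countable"
begin

text \<open>
  Sliding a window of length n along the word by one position changes the number of occurrences
  of a letter in it by at most one. These numbers therefore fill an interval, and since windows
  with different numbers are not Abelian equivalent, a bound B on the Abelian complexity
  bounds the length of this interval: any two factors of the same length have
  letter counts that differ by less than B (lemma \<open>letter_count_balanced\<close>).

  Now colour each position n by the vector of the letter counts of the prefix of length n, reduced
  modulo B. Van der Waerden's theorem (\<open>van_der_Waerden\<close>) gives a monochromatic
  arithmetic progression of k + 1 positions. It cuts out k consecutive blocks of the same length,
  in which every letter count is divisible by B. Counts of the same letter in two of the blocks
  differ by less than B, so they are equal, and the k blocks form an Abelian k-power.

  Van der Waerden's theorem is proved by induction on the length of the progression, with colour
  focusing: if an interval contains s progressions of k points that have distinct colours and a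
  common preceding point, the focus, then either the focus extends one of them to k + 1 points, or
  a longer interval contains s + 1 such progressions (\<open>add_focused_progression\<close>). As s cannot exceed
  the number of colours, a progression of k + 1 points must appear.
\<close>

section \<open>Van der Waerden's theorem\<close>

text \<open>
  The progression has k + 1 points: it arises from one of k points by adding the focus in front.
\<close>
definition mono_ap :: "(nat \<Rightarrow> 'c) \<Rightarrow> nat \<Rightarrow> nat \<Rightarrow> bool" where
  "mono_ap f k N \<longleftrightarrow> (\<exists>a d. 0 < d \<and> a + k * d < N \<and> (\<forall>i\<le>k. f (a + i * d) = f a))"

text \<open>
  The progressions a + d, ..., a + k * d for d in D are monochromatic, their colours are
  pairwise distinct, and they share the focus a, the point preceding each of
  them. The colour of the focus itself is not prescribed.
\<close>
definition focused :: "(nat \<Rightarrow> 'c) \<Rightarrow> nat \<Rightarrow> nat \<Rightarrow> nat \<Rightarrow> nat set \<Rightarrow> bool" where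
  "focused f k N a D \<longleftrightarrow> a < N \<and> finite D \<and> inj_on (\<lambda>d. f (a + d)) D \<and>
     (\<forall>d\<in>D. 0 < d \<and> a + k * d < N \<and> (\<forall>i\<in>{1..k}. f (a + i * d) = f (a + d)))"

text \<open>
  Van der Waerden's theorem for progressions of k points, with a bound N that serves all colourings
  with colours in C. The progression is required to have a predecessor a inside the
  interval, so that a can serve as a focus. Colours are natural numbers because the induction
  applies the statement to colour patterns of blocks, which are coded back into colours.
\<close>
definition vdW_bound :: "nat \<Rightarrow> nat set \<Rightarrow> nat \<Rightarrow> bool" where
  "vdW_bound k C N \<longleftrightarrow> (\<forall>f. range f \<subseteq> C \<longrightarrow>
     (\<exists>a d. 0 < d \<and> a + k * d < N \<and> (\<forall>i\<in>{1..k}. f (a + i * d) = f (a + d))))"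

lemma mono_ap_shift:
  assumes "mono_ap (\<lambda>n. f (b + n)) k N" "b + N \<le> N'"
  shows "mono_ap f k N'"
proof -
  obtain a d where "0 < d" "a + k * d < N" "\<forall>i\<le>k. f (b + (a + i * d)) = f (b + a)"
    using assms(1) unfolding mono_ap_def by blast
  then show ?thesis unfolding mono_ap_def using assms(2)
    by (intro exI[of _ "b + a"] exI[of _ d]) (auto simp: add.assoc)
qed

text \<open>
  If the focus already has the colour of one of the progressions, prepending it gives a longer
  one. Otherwise the colour of the focus is new, and this is exploited by viewing the whole
  interval as one block among many: by van der Waerden's theorem for k, applied to the colour
  patterns of the blocks, some block is repeated k times with period \<open>\<delta>\<close>. Stretching every
  step d to \<open>\<delta> * N + d\<close> makes the progressions run through the repeated blocks, and the k copies
  of the old focus are one more progression, of step \<open>\<delta> * N\<close>. All of them are focused at the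
  point that corresponds to the old focus in the block before the repeated ones.
\<close>
lemma add_focused_progression:
  fixes f :: "nat \<Rightarrow> nat"
  assumes blocks: "0 < \<delta>" "m + k * \<delta> < W"
    and same: "\<And>i j. i \<in> {1..k} \<Longrightarrow> j < N \<Longrightarrow> f ((m + i * \<delta>) * N + j) = f ((m + \<delta>) * N + j)"
    and foc: "focused (\<lambda>n. f ((m + \<delta>) * N + n)) k N a D"
    and k: "0 < k"
    and no_ap: "\<not> mono_ap f k (W * N)"
  shows "\<exists>a' D'. focused f k (W * N) a' D' \<and> card D' = Suc (card D)"
proof -
  define g where "g = (\<lambda>n. f ((m + \<delta>) * N + n))"
  have aN: "a < N" and finD: "finite D" and inj: "inj_on (\<lambda>d. g (a + d)) D"
    and D: "\<And>d. d \<in> D \<Longrightarrow> 0 < d \<and> a + k * d < N"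
    and Dg: "\<And>d i. d \<in> D \<Longrightarrow> i \<in> {1..k} \<Longrightarrow> g (a + i * d) = g (a + d)"
    using foc unfolding focused_def g_def by auto
  have N: "0 < N" using aN by simp
  have in_range: "(m + i * \<delta>) * N + j < W * N" if "i \<le> k" "j < N" for i j
  proof -
    have "m + i * \<delta> \<le> m + k * \<delta>" using that(1) by simp
    then have "Suc (m + i * \<delta>) \<le> W" using blocks(2) by linarith
    then have "Suc (m + i * \<delta>) * N \<le> W * N" by (rule mult_le_mono1)
    then show ?thesis using that(2) by simp
  qed
  have new: "g a \<noteq> g (a + d)" if "d \<in> D" for d
  proof
    assume eq: "g a = g (a + d)"
    have "g (a + i * d) = g a" if "i \<le> k" for i
      using Dg[OF \<open>d \<in> D\<close>, of i] eq that by (cases "i = 0") auto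
    then have "mono_ap g k N"
      unfolding mono_ap_def using D[OF \<open>d \<in> D\<close>] by blast
    moreover have "(m + \<delta>) * N + N \<le> W * N"
    proof -
      have "\<delta> \<le> k * \<delta>" using k by simp
      then have "Suc (m + \<delta>) \<le> W" using blocks(2) by linarith
      then have "Suc (m + \<delta>) * N \<le> W * N" by (rule mult_le_mono1)
      then show ?thesis by simp
    qed
    ultimately show False using no_ap mono_ap_shift[of f "(m + \<delta>) * N" k N "W * N"]
      unfolding g_def by blast
  qed
  define a' where "a' = m * N + a"
  \<comment> \<open>The element 0 of \<open>insert 0 D\<close> stands for the progression formed by the copies of the focus.\<close>
  define D' where "D' = (\<lambda>d. \<delta> * N + d) ` insert 0 D"
  have pos: "a' + i * (\<delta> * N + d) = (m + i * \<delta>) * N + (a + i * d)" for i d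
    unfolding a'_def by (simp add: algebra_simps)
  have bound: "a + i * d < N" if "d \<in> insert 0 D" "i \<le> k" for i d
  proof -
    have "i * d \<le> k * d" using that(2) by simp
    moreover have "a + k * d < N" using that(1) D aN by auto
    ultimately show ?thesis by linarith
  qed
  have colour: "f (a' + i * (\<delta> * N + d)) = g (a + d)" if "d \<in> insert 0 D" "i \<in> {1..k}" for i d
  proof -
    have "f (a' + i * (\<delta> * N + d)) = g (a + i * d)"
      unfolding pos g_def using same[OF that(2)] bound[OF that(1)] that(2) by simp
    also have "\<dots> = g (a + d)" using that Dg by auto
    finally show ?thesis .
  qed
  have colour1: "f (a' + (\<delta> * N + d)) = g (a + d)" if "d \<in> insert 0 D" for d
    using colour[OF that, of 1] k by simp
  have inj0: "inj_on (\<lambda>d. g (a + d)) (insert 0 D)"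
    using inj new D by (fastforce simp: inj_on_def)
  have "inj_on (\<lambda>d. f (a' + d)) D'"
    unfolding D'_def inj_on_def
  proof (intro ballI impI)
    fix p q assume p: "p \<in> (\<lambda>d. \<delta> * N + d) ` insert 0 D" and q: "q \<in> (\<lambda>d. \<delta> * N + d) ` insert 0 D"
      and eq: "f (a' + p) = f (a' + q)"
    obtain d where d: "p = \<delta> * N + d" "d \<in> insert 0 D" using p by (rule imageE)
    obtain e where e: "q = \<delta> * N + e" "e \<in> insert 0 D" using q by (rule imageE)
    have "g (a + d) = g (a + e)" using eq colour1[OF d(2)] colour1[OF e(2)] d(1) e(1) by simp
    then have "d = e" by (rule inj_onD[OF inj0 _ d(2) e(2)])
    then show "p = q" using d(1) e(1) by simp
  qed
  moreover have "0 < d \<and> a' + k * d < W * N \<and> (\<forall>i\<in>{1..k}. f (a' + i * d) = f (a' + d))"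
    if d: "d \<in> D'" for d
  proof -
    obtain e where e: "d = \<delta> * N + e" "e \<in> insert 0 D"
      using d unfolding D'_def by (rule imageE)
    have "0 < d" using e(1) blocks(1) N by simp
    moreover have "a' + k * d < W * N"
      unfolding e(1) pos by (rule in_range) (use bound[OF e(2)] in auto)
    ultimately show ?thesis using colour[OF e(2)] colour1[OF e(2)] e(1) by simp
  qed
  moreover have "a' < W * N" using in_range[of 0 a] aN by (simp add: a'_def)
  ultimately have "focused f k (W * N) a' D'"
    unfolding focused_def using finD by (auto simp: D'_def)
  moreover have "card D' = Suc (card D)"
  proof -
    have "0 \<notin> D" using D by blast
    then have "card (insert 0 D) = Suc (card D)" using finD by simp
    moreover have "card D' = card (insert 0 D)"
      unfolding D'_def by (rule card_image) (simp add: inj_on_def)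
    ultimately show ?thesis by simp
  qed
  ultimately show ?thesis by blast
qed

text \<open>
  A block of N positions carries one of finitely many colour patterns, and the pattern, coded as a
  number, is a colour of the block. This is why the induction hypothesis has to cover every finite
  set of colours.
\<close>
lemma vdW_bound_blocks:
  fixes C :: "nat set"
  assumes IH: "\<And>C. finite C \<Longrightarrow> \<exists>N. vdW_bound k C N" and "finite C"
  shows "\<exists>W. \<forall>f :: nat \<Rightarrow> nat. range f \<subseteq> C \<longrightarrow> (\<exists>m \<delta>. 0 < \<delta> \<and> m + k * \<delta> < W \<and>
    (\<forall>i\<in>{1..k}. \<forall>j<N. f ((m + i * \<delta>) * N + j) = f ((m + \<delta>) * N + j)))"
proof -
  define L where "L = to_nat ` {xs. set xs \<subseteq> C \<and> length xs = N}"
  have "finite L" unfolding L_def using \<open>finite C\<close> by (intro finite_imageI finite_lists_length_eq)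
  then obtain W where W: "vdW_bound k L W" using IH by blast
  show ?thesis
  proof (rule exI[of _ W], intro allI impI)
    fix f :: "nat \<Rightarrow> nat" assume f: "range f \<subseteq> C"
    define p where "p = (\<lambda>m. map (\<lambda>j. f (m * N + j)) [0..<N])"
    have "range (\<lambda>m. to_nat (p m)) \<subseteq> L" using f by (auto simp: L_def p_def image_subset_iff intro!: imageI)
    then obtain m \<delta> where m: "0 < \<delta>" "m + k * \<delta> < W"
      and eq: "\<forall>i\<in>{1..k}. to_nat (p (m + i * \<delta>)) = to_nat (p (m + \<delta>))"
      using W unfolding vdW_bound_def by blast
    have "f ((m + i * \<delta>) * N + j) = f ((m + \<delta>) * N + j)" if "i \<in> {1..k}" "j < N" for i j
    proof -
      have "p (m + i * \<delta>) ! j = p (m + \<delta>) ! j" using eq that(1) by simp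
      then show ?thesis using that(2) by (simp add: p_def)
    qed
    then show "\<exists>m \<delta>. 0 < \<delta> \<and> m + k * \<delta> < W \<and>
      (\<forall>i\<in>{1..k}. \<forall>j<N. f ((m + i * \<delta>) * N + j) = f ((m + \<delta>) * N + j))"
      using m by blast
  qed
qed

lemma mono_ap_or_focused:
  fixes C :: "nat set"
  assumes IH: "\<And>C. finite C \<Longrightarrow> \<exists>N. vdW_bound k C N" and "finite C" and k: "0 < k"
  shows "\<exists>N. \<forall>f. range f \<subseteq> C \<longrightarrow>
    mono_ap f k N \<or> (\<exists>a D. focused f k N a D \<and> card D = s)"
proof (induction s)
  case 0
  show ?case by (rule exI[of _ 1]) (auto simp: focused_def intro!: exI[of _ "{}"])
next
  case (Suc s)
  then obtain N where N: "\<And>f. range f \<subseteq> C \<Longrightarrow>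
    mono_ap f k N \<or> (\<exists>a D. focused f k N a D \<and> card D = s)" by blast
  obtain W where W: "\<And>f. range f \<subseteq> C \<Longrightarrow> \<exists>m \<delta>. 0 < \<delta> \<and> m + k * \<delta> < W \<and>
    (\<forall>i\<in>{1..k}. \<forall>j<N. f ((m + i * \<delta>) * N + j) = f ((m + \<delta>) * N + j))"
    using vdW_bound_blocks[OF IH \<open>finite C\<close>, of N] by blast
  show ?case
  proof (intro exI[of _ "W * N"] allI impI)
    fix f :: "nat \<Rightarrow> nat" assume f: "range f \<subseteq> C"
    have "\<exists>a D. focused f k (W * N) a D \<and> card D = Suc s" if no_ap: "\<not> mono_ap f k (W * N)"
    proof -
      obtain m \<delta> where m: "0 < \<delta>" "m + k * \<delta> < W"
        and same: "\<forall>i\<in>{1..k}. \<forall>j<N. f ((m + i * \<delta>) * N + j) = f ((m + \<delta>) * N + j)"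
        using W[OF f] by blast
      have "\<delta> \<le> k * \<delta>" using k by simp
      then have "Suc (m + \<delta>) \<le> W" using m(2) by linarith
      then have "Suc (m + \<delta>) * N \<le> W * N" by (rule mult_le_mono1)
      then have "\<not> mono_ap (\<lambda>n. f ((m + \<delta>) * N + n)) k N"
        using no_ap mono_ap_shift[of f "(m + \<delta>) * N" k N "W * N"] by auto
      moreover have "range (\<lambda>n. f ((m + \<delta>) * N + n)) \<subseteq> C" using f by auto
      ultimately obtain a D where "focused (\<lambda>n. f ((m + \<delta>) * N + n)) k N a D" "card D = s"
        using N by blast
      then show ?thesis
        using add_focused_progression[OF m _ _ k no_ap] same by blast
    qed
    then show "mono_ap f k (W * N) \<or> (\<exists>a D. focused f k (W * N) a D \<and> card D = Suc s)"
      by blast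
  qed
qed

text \<open>
  The induction on s stops at one more than the number of colours:
  focused progressions have distinct colours, so there cannot be more of them than colours.
\<close>
lemma mono_ap_bound:
  fixes C :: "nat set"
  assumes IH: "\<And>C. finite C \<Longrightarrow> \<exists>N. vdW_bound k C N" and "finite C" and "0 < k"
  shows "\<exists>N. \<forall>f. range f \<subseteq> C \<longrightarrow> mono_ap f k N"
proof -
  obtain N where N: "\<And>f. range f \<subseteq> C \<Longrightarrow>
    mono_ap f k N \<or> (\<exists>a D. focused f k N a D \<and> card D = Suc (card C))"
    using mono_ap_or_focused[OF assms, of "Suc (card C)"] by auto
  have "\<not> focused f k N a D" if "range f \<subseteq> C" "card D = Suc (card C)" for f a D
  proof
    assume "focused f k N a D"
    then have "inj_on (\<lambda>d. f (a + d)) D" by (simp add: focused_def)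
    moreover have "(\<lambda>d. f (a + d)) ` D \<subseteq> C" using that(1) by auto
    ultimately have "card D \<le> card C" using \<open>finite C\<close> by (rule card_inj_on_le)
    then show False using that(2) by simp
  qed
  then have "mono_ap f k N" if "range f \<subseteq> C" for f using N[OF that] that by blast
  then show ?thesis by blast
qed

lemma ex_vdW_bound: "finite C \<Longrightarrow> \<exists>N. vdW_bound (Suc k) C N"
proof (induction k arbitrary: C)
  case 0
  have "vdW_bound (Suc 0) C 2"
    unfolding vdW_bound_def by (intro allI impI exI[of _ 0] exI[of _ 1]) auto
  then show ?case by blast
next
  case (Suc k)
  then obtain N where N: "\<And>f. range f \<subseteq> C \<Longrightarrow> mono_ap f (Suc k) N"
    using mono_ap_bound[of "Suc k" C] by blast
  have "vdW_bound (Suc (Suc k)) C (2 * N)"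
    unfolding vdW_bound_def
  proof (intro allI impI)
    fix f :: "nat \<Rightarrow> nat" assume "range f \<subseteq> C"
    \<comment> \<open>Searching in the upper half of the interval leaves room for the predecessor.\<close>
    then have "mono_ap (\<lambda>n. f (N + n)) (Suc k) N" by (intro N) auto
    then obtain a d where d: "0 < d" "a + Suc k * d < N"
      and eq: "\<And>i. i \<le> Suc k \<Longrightarrow> f (N + (a + i * d)) = f (N + a)"
      unfolding mono_ap_def by blast
    have "d \<le> N" using d(2) by simp
    have shift: "N + a - d + Suc i * d = N + (a + i * d)" for i using \<open>d \<le> N\<close> by simp
    have "f (N + a - d + i * d) = f (N + a - d + d)" if i: "i \<in> {1..Suc (Suc k)}" for i
    proof -
      obtain j where "i = Suc j" using i by (cases i) auto
      then show ?thesis using i eq[of j] shift[of j] \<open>d \<le> N\<close> by simp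
    qed
    moreover have "N + a - d + Suc (Suc k) * d < 2 * N" unfolding shift using d(2) by simp
    ultimately show "\<exists>a d. 0 < d \<and> a + Suc (Suc k) * d < 2 * N \<and>
      (\<forall>i\<in>{1..Suc (Suc k)}. f (a + i * d) = f (a + d))" using d(1) by blast
  qed
  then show ?case by blast
qed

text \<open>
  Only finitely many colours occur, so they can be numbered.
\<close>
theorem van_der_Waerden:
  fixes f :: "nat \<Rightarrow> 'c"
  assumes "finite (range f)"
  obtains a d where "0 < d" "\<And>i. i \<le> k \<Longrightarrow> f (a + i * d) = f a"
proof -
  obtain h :: "'c \<Rightarrow> nat" where h: "inj_on h (range f)"
    using finite_imp_inj_to_nat_seg[OF assms] by blast
  obtain N where "vdW_bound (Suc k) (range (h \<circ> f)) N"
    using ex_vdW_bound[of "range (h \<circ> f)" k] assms by (metis finite_imageI image_comp)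
  then obtain a d where "0 < d"
    and eq: "\<And>i. i \<in> {1..Suc k} \<Longrightarrow> h (f (a + i * d)) = h (f (a + d))"
    unfolding vdW_bound_def by (metis comp_apply order_refl)
  have "f (a + d + i * d) = f (a + d)" if "i \<le> k" for i
    using eq[of "Suc i"] that h by (auto simp: inj_on_def add.assoc)
  with \<open>0 < d\<close> that show thesis by blast
qed

section \<open>Bounded Abelian complexity implies balance\<close>

lemma abs_count_slide_le_1:
  "\<bar>int (count_list (w[Suc i \<rightarrow> Suc i + n]) a) - int (count_list (w[i \<rightarrow> i + n]) a)\<bar> \<le> 1"
proof -
  have "(w[i \<rightarrow> i + n]) @ [w (i + n)] = w i # (w[Suc i \<rightarrow> Suc i + n])"
  proof -
    have "[i..<i + n] @ [i + n] = i # [Suc i..<Suc i + n]"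
      by (metis add_Suc le_add1 le_imp_less_Suc upt_Suc_append upt_conv_Cons)
    then have "map w ([i..<i + n] @ [i + n]) = map w (i # [Suc i..<Suc i + n])" by simp
    then show ?thesis by (simp only: subsequence_def map_append list.map)
  qed
  then have "count_list ((w[i \<rightarrow> i + n]) @ [w (i + n)]) a =
    count_list (w i # (w[Suc i \<rightarrow> Suc i + n])) a"
    by simp
  then show ?thesis by (auto split: if_splits)
qed

text \<open>
  Discrete intermediate values. The position i of the smaller value may come before or after j; in
  the second case the negated sequence is used.
\<close>
lemma slow_sequence_interval:
  fixes c :: "nat \<Rightarrow> int"
  assumes slow: "\<And>i. \<bar>c (Suc i) - c i\<bar> \<le> 1"
  shows "{c i..c j} \<subseteq> range c"
proof
  fix v assume v: "v \<in> {c i..c j}"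
  show "v \<in> range c"
  proof (cases "i \<le> j")
    case True
    then have "\<exists>l\<ge>i. l \<le> j \<and> c l = v"
      using v slow by (intro nat_intermed_int_val) auto
    then show ?thesis by blast
  next
    case False
    have "\<exists>l\<ge>j. l \<le> i \<and> - c l = - v"
      using v slow False by (intro nat_intermed_int_val[where f = "\<lambda>l. - c l"]) (auto simp: abs_minus_commute)
    then show ?thesis by auto
  qed
qed

text \<open>
  The number of occurrences of a is constant on each class, so it can be read off from any
  representative, and every value comes from a class.
\<close>
lemma card_counts_le_abelian_complexity:
  assumes "finite A" "range w \<subseteq> A"
  shows "card (range (\<lambda>i. count_list (w[i \<rightarrow> i + n]) a)) \<le> abelian_complexity w n"
proof -
  define F where "F = {u \<in> factors w. length u = n}"
  define R where "R = {(u :: 'a list, v). abelian_equiv u v}"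
  have "F \<subseteq> {xs. set xs \<subseteq> A \<and> length xs = n}"
    by (auto simp: F_def factors_def intro: range_subsetD[OF assms(2)])
  then have finF: "finite F"
    by (rule finite_subset) (rule finite_lists_length_eq[OF assms(1)])
  have "F // R = (\<lambda>u. R `` {u}) ` F" by (auto simp: quotient_def)
  then have fin: "finite (F // R)" using finF by simp
  have "range (\<lambda>i. count_list (w[i \<rightarrow> i + n]) a) \<subseteq> (\<lambda>X. count_list (SOME u. u \<in> X) a) ` (F // R)"
  proof
    fix v assume "v \<in> range (\<lambda>i. count_list (w[i \<rightarrow> i + n]) a)"
    then obtain i where v: "v = count_list (w[i \<rightarrow> i + n]) a" by blast
    define X where "X = R `` {w[i \<rightarrow> i + n]}"
    define t where "t = (SOME u. u \<in> X)"
    have "w[i \<rightarrow> i + n] \<in> F" by (force simp: F_def factors_def)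
    then have "X \<in> F // R" unfolding X_def by (rule quotientI)
    have "w[i \<rightarrow> i + n] \<in> X" by (simp add: X_def R_def abelian_equiv_def)
    then have "t \<in> X" unfolding t_def by (rule someI)
    then have "v = count_list t a" by (simp add: v X_def R_def abelian_equiv_def)
    with \<open>X \<in> F // R\<close> show "v \<in> (\<lambda>X. count_list (SOME u. u \<in> X) a) ` (F // R)"
      unfolding t_def by (rule rev_image_eqI)
  qed
  then have "card (range (\<lambda>i. count_list (w[i \<rightarrow> i + n]) a)) \<le> card (F // R)"
    by (meson card_image_le card_mono fin finite_imageI le_trans)
  then show ?thesis by (simp add: abelian_complexity_def F_def R_def)
qed

lemma letter_count_balanced:
  assumes "finite A" "range w \<subseteq> A" and B: "abelian_complexity w n \<le> B"
  shows "count_list (w[j \<rightarrow> j + n]) a < count_list (w[i \<rightarrow> i + n]) a + B"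
proof -
  define c where "c = (\<lambda>i. count_list (w[i \<rightarrow> i + n]) a)"
  have fin: "finite (range c)"
  proof (rule finite_subset)
    show "range c \<subseteq> {..n}"
      by (auto simp: c_def intro!: order.trans[OF count_le_length])
  qed simp
  have "{int (c i)..int (c j)} \<subseteq> range (\<lambda>i. int (c i))"
    unfolding c_def by (rule slow_sequence_interval) (rule abs_count_slide_le_1)
  also have "\<dots> = int ` range c" by auto
  finally have "card {int (c i)..int (c j)} \<le> card (int ` range c)"
    using fin by (intro card_mono) auto
  also have "\<dots> = card (range c)" by (simp add: card_image)
  also have "\<dots> \<le> B"
    using card_counts_le_abelian_complexity[OF assms(1,2), of n a] B by (simp add: c_def)
  finally have *: "nat (int (c j) - int (c i) + 1) \<le> B" by simp
  have "0 < card (range c)" using fin by (simp add: card_gt_0_iff)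
  with \<open>card (range c) \<le> B\<close> have "0 < B" by linarith
  with * show ?thesis unfolding c_def by linarith
qed

section \<open>Abelian powers\<close>

lemma concat_consecutive_blocks:
  "concat (map (\<lambda>i. (w[s + i * d \<rightarrow> s + i * d + d])) [0..<k]) = (w[s \<rightarrow> s + k * d])"
proof (induction k)
  case (Suc k)
  have "(w[s \<rightarrow> s + k * d]) @ (w[s + k * d \<rightarrow> s + k * d + d]) = (w[s \<rightarrow> s + k * d + d])"
    using upt_add_eq_append[of s "s + k * d" d] by (simp add: subsequence_def)
  then show ?case using Suc by (simp add: add_ac)
qed (simp add: subsequence_def)

theorem theorem8:
  fixes A :: "'a set" and \<omega> :: "'a word"
  assumes "finite A"
    and "range \<omega> \<subseteq> A"
    and "bdd_above (range (abelian_complexity \<omega>))"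
  shows "\<forall>k::nat. k \<ge> 1 \<longrightarrow> (\<exists>x \<in> factors \<omega>. abelian_power k x)"
proof (intro allI impI)
  fix k :: nat assume k: "k \<ge> 1"
  obtain B where B: "\<And>n. abelian_complexity \<omega> n \<le> B"
    using assms(3) by (auto simp: bdd_above_def)
  note balanced = letter_count_balanced[OF assms(1,2) B]
  have "0 < B" using balanced[of 0 0 undefined 0] by simp
  define P where "P = (\<lambda>n a. count_list (\<omega>[0 \<rightarrow> n]) a)"
  define f where "f = (\<lambda>n a. P n a mod B)"
  have "range f \<subseteq> {g. \<forall>a. (a \<in> A \<longrightarrow> g a \<in> {..<B}) \<and> (a \<notin> A \<longrightarrow> g a = 0)}"
  proof -
    have "P n a = 0" if "a \<notin> A" for n a
      unfolding P_def using assms(2) that by (intro count_notin) (auto simp: subsequence_def)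
    then show ?thesis using \<open>0 < B\<close> by (auto simp: f_def)
  qed
  then have "finite (range f)"
    by (rule finite_subset) (intro finite_set_of_finite_funs assms(1) finite_lessThan)
  then obtain s d where d: "0 < d" and mono: "\<And>i. i \<le> k \<Longrightarrow> f (s + i * d) = f s"
    using van_der_Waerden[of f k] by blast
  define u where "u = (\<lambda>i. (\<omega>[s + i * d \<rightarrow> s + i * d + d]))"
  have P_step: "P (s + i * d + d) a = P (s + i * d) a + count_list (u i) a" for i a
  proof -
    have "\<omega>[0 \<rightarrow> s + i * d + d] = (\<omega>[0 \<rightarrow> s + i * d]) @ u i"
      using upt_add_eq_append[of 0 "s + i * d" d] by (simp add: subsequence_def u_def)
    then show ?thesis by (simp add: P_def)
  qed
  \<comment> \<open>Both ends of a block have the same colour, that is, the same prefix counts modulo B.\<close>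
  have dvd: "B dvd count_list (u i) a" if "i < k" for i a
  proof -
    have "f (s + i * d) = f (s + Suc i * d)" using mono[of i] mono[of "Suc i"] that by simp
    then have "f (s + i * d) a = f (s + i * d + d) a" by (simp add: add_ac)
    then have "P (s + i * d + d) a mod B = P (s + i * d) a mod B" by (simp add: f_def)
    then show ?thesis
      unfolding P_step by (metis add_diff_cancel_left' le_add1 mod_eq_dvd_iff_nat)
  qed
  have equiv: "abelian_equiv (u i) (u j)" if "i < k" "j < k" for i j
    unfolding abelian_equiv_def
  proof
    fix a
    have eq: "c = c'" if dvds: "B dvd c" "B dvd c'" and less: "c < c' + B" "c' < c + B" for c c' :: nat
    proof -
      obtain q q' where q: "c = B * q" "c' = B * q'" using dvds by (auto simp: dvd_def)
      have "B * q < B * Suc q'" "B * q' < B * Suc q" using less q by simp_all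
      then have "q < Suc q'" "q' < Suc q" by (simp_all only: mult_less_cancel1)
      then show ?thesis using q by simp
    qed
    show "count_list (u i) a = count_list (u j) a"
      using dvd that balanced unfolding u_def by (intro eq) auto
  qed
  define x where "x = (\<omega>[s \<rightarrow> s + k * d])"
  have "x = concat (map u [0..<k])" unfolding x_def u_def by (simp only: concat_consecutive_blocks)
  moreover have "x \<noteq> []" using k d by (simp add: x_def subsequence_def)
  ultimately have "abelian_power k x"
    unfolding abelian_power_def using equiv by (intro conjI exI[of _ "map u [0..<k]"]) auto
  moreover have "x \<in> factors \<omega>" unfolding x_def factors_def by force
  ultimately show "\<exists>x\<in>factors \<omega>. abelian_power k x" by blast
qed

end
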